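(* For a plane (rooted, ordered) tree $T$ in which every internal node has at least $2$ children, define a polynomial $F_T(1)\in\mathbb{Q}[t]$ recursively: if $T$ is a single leaf, $F_T(1)=1$; if the root of $T$ has children subtrees $T_1,\ldots,T_k$ (in order, $k\ge 2$), then $F_T(1)=F_k(F_{T_1}(1),\ldots,F_{T_k}(1))$, where $F_k(x_1,\ldots,x_k)=\Sigma_0^t x_1(s)x_2(s)\cdots x_k(s)\,\delta s$ and, for a polynomial $f$, $\Sigma_0^t f(s)\,\delta s$ is the polynomial $P\in\mathbb{Q}[t]$ with $P(t)=\sum_{i=0}^{t-1}f(i)$ for all nonnegative integers $t$. Write $F_T(1)=\sum_k c_k\binom{t}{k}$. Then for every $k$, $c_k$ equals the number of packed words $u$ with maximal letter $k$ such that $\mathcal{T}(u)=T$.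
   Context: A word $u$ over the positive integers is packed if the set of letters occurring in it is $\{1,2,\ldots,k\}$ for some $k\ge 0$ (the empty word is packed, with maximal letter $0$). With any word $w$ one associates a plane tree $\mathcal{T}(w)$ recursively: $\mathcal{T}$ of the empty word is the tree consisting of a single leaf; if $w$ is nonempty, $m=\max(w)$ and $m$ occurs exactly $k-1$ times in $w$, write $w=v_1\,m\,v_2\,m\cdots v_{k-1}\,m\,v_k$ (the $v_i$ possibly empty), and $\mathcal{T}(w)$ is the tree whose root has children subtrees $\mathcal{T}(v_1),\mathcal{T}(v_2),\ldots,\mathcal{T}(v_k)$ in this order. (Thus a word of length $n$ gives a plane tree with $n+1$ leaves in which each internal node has at least two children.) *)

theory Defs
  imports Complex_Main "HOL-Computational_Algebra.Polynomial"
begin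

section \<open>Plane trees and words\<close>

datatype plane_tree = Leaf | Node "plane_tree list"

text \<open>Every internal node has at least two children.  This also excludes \<open>Node []\<close>, which
  would be a second kind of leaf.\<close>

fun reduced :: "plane_tree \<Rightarrow> bool" where
  "reduced Leaf \<longleftrightarrow> True"
| "reduced (Node ts) \<longleftrightarrow> length ts \<ge> 2 \<and> (\<forall>t\<in>set ts. reduced t)"

definition packed :: "nat list \<Rightarrow> bool" where
  "packed u \<longleftrightarrow> (\<exists>k. set u = {1..k})"

text \<open>The inserted \<open>0\<close> only matters for the empty word, whose maximal letter is \<open>0\<close>.\<close>

definition max_letter :: "nat list \<Rightarrow> nat" where
  "max_letter u = Max (insert 0 (set u))"

text \<open>\<open>split_at m w\<close> is the list \<open>[v\<^sub>1, \<dots>, v\<^sub>k]\<close> of possibly empty words without the letter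
  \<open>m\<close> such that \<open>w = v\<^sub>1 m v\<^sub>2 m \<dots> v\<^bsub>k-1\<^esub> m v\<^sub>k\<close>; see \<open>split_at_eq_iff\<close> below.\<close>

fun split_at :: "'a \<Rightarrow> 'a list \<Rightarrow> 'a list list" where
  "split_at m [] = [[]]"
| "split_at m (x # xs) =
     (if x = m then [] # split_at m xs
      else (x # hd (split_at m xs)) # tl (split_at m xs))"

fun join_with :: "'a \<Rightarrow> 'a list list \<Rightarrow> 'a list" where
  "join_with m [] = []"
| "join_with m [v] = v"
| "join_with m (v # v' # vs) = v @ m # join_with m (v' # vs)"

lemma split_at_not_Nil [simp]: "split_at m w \<noteq> []"
  by (cases w) auto

lemma split_at_no_letter: "m \<notin> set v \<Longrightarrow> split_at m v = [v]"
  by (induction v) auto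

lemma split_at_append: "m \<notin> set v \<Longrightarrow> split_at m (v @ m # w) = v # split_at m w"
  by (induction v) auto

lemma join_with_split_at: "join_with m (split_at m w) = w"
proof (induction w)
  case (Cons x xs)
  obtain v vs where "split_at m xs = v # vs"
    by (cases "split_at m xs") auto
  with Cons show ?case by (cases vs) auto
qed simp

lemma split_at_pieces: "v \<in> set (split_at m w) \<Longrightarrow> m \<notin> set v"
proof (induction w arbitrary: v)
  case (Cons x xs)
  obtain v' vs where "split_at m xs = v' # vs"
    by (cases "split_at m xs") auto
  with Cons show ?case by (auto split: if_splits)
qed simp

lemma split_at_join_with:
  "vs \<noteq> [] \<Longrightarrow> \<forall>v\<in>set vs. m \<notin> set v \<Longrightarrow> split_at m (join_with m vs) = vs"
  by (induction m vs rule: join_with.induct) (auto simp: split_at_no_letter split_at_append)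

lemma split_at_eq_iff:
  "split_at m w = vs \<longleftrightarrow> vs \<noteq> [] \<and> w = join_with m vs \<and> (\<forall>v\<in>set vs. m \<notin> set v)"
  using join_with_split_at split_at_join_with split_at_pieces split_at_not_Nil by metis

lemma length_split_at: "length (split_at m w) = Suc (count_list w m)"
  by (induction w) auto

lemma sum_list_length_split_at:
  "(\<Sum>v\<leftarrow>split_at m w. Suc (length v)) = Suc (length w)"
proof (induction w)
  case (Cons x xs)
  obtain v vs where "split_at m xs = v # vs"
    by (cases "split_at m xs") auto
  with Cons show ?case by auto
qed simp

lemma length_piece_le:
  assumes "v \<in> set (split_at m w)"
  shows "length v \<le> length w"
proof -
  have "Suc (length v) \<le> (\<Sum>v\<leftarrow>split_at m w. Suc (length v))"
    using assms by (intro member_le_sum_list) auto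
  then show ?thesis by (simp add: sum_list_length_split_at)
qed

lemma length_piece_less:
  assumes "v \<in> set (split_at m w)" "m \<in> set w"
  shows "length v < length w"
  using assms
proof (induction w arbitrary: v)
  case (Cons x xs)
  obtain v' vs where *: "split_at m xs = v' # vs"
    by (cases "split_at m xs") auto
  show ?case
  proof (cases "x = m")
    case True
    with Cons.prems show ?thesis
      by (auto simp: less_Suc_eq_le dest: length_piece_le)
  next
    case False
    with Cons.prems Cons.IH[of v'] Cons.IH[of v] * show ?thesis
      by (auto simp: less_Suc_eq)
  qed
qed simp

function word_tree :: "nat list \<Rightarrow> plane_tree" where
  "word_tree [] = Leaf"
| "w \<noteq> [] \<Longrightarrow> word_tree w = Node (map word_tree (split_at (max_letter w) w))"
  by atomize_elim auto
termination
proof (relation "measure length")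
  fix w v :: "nat list"
  assume w: "w \<noteq> []" and v: "v \<in> set (split_at (max_letter w) w)"
  from w have "max_letter w = Max (set w)"
    by (simp add: max_letter_def)
  with w have "max_letter w \<in> set w" by simp
  with v show "(v, w) \<in> measure length"
    by (simp add: length_piece_less)
qed simp


section \<open>The polynomial of a plane tree\<close>

text \<open>\<open>delta_sum f\<close> is \<open>\<Sigma>\<^sub>0\<^sup>t f(s) \<delta>s\<close>.\<close>

definition delta_sum :: "rat poly \<Rightarrow> rat poly" where
  "delta_sum f = (THE P. \<forall>n::nat. poly P (of_nat n) = (\<Sum>i<n. poly f (of_nat i)))"

definition binomial_poly :: "nat \<Rightarrow> rat poly" where
  "binomial_poly k = smult (1 / fact k) (\<Prod>i<k. [:- of_nat i, 1:])"

definition binomial_expansion :: "rat poly \<Rightarrow> (nat \<Rightarrow> rat) \<Rightarrow> bool" where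
  "binomial_expansion p c \<longleftrightarrow>
     finite {k. c k \<noteq> 0} \<and> p = (\<Sum>k | c k \<noteq> 0. smult (c k) (binomial_poly k))"

definition binomial_coeff :: "rat poly \<Rightarrow> nat \<Rightarrow> rat" where
  "binomial_coeff p = (THE c. binomial_expansion p c)"

definition F_op :: "rat poly list \<Rightarrow> rat poly" where
  "F_op xs = delta_sum (prod_list xs)"

fun tree_poly :: "plane_tree \<Rightarrow> rat poly" where
  "tree_poly Leaf = 1"
| "tree_poly (Node ts) = F_op (map tree_poly ts)"


subsection \<open>Well-definedness\<close>

lemma poly_binomial_poly: "poly (binomial_poly k) x = x gchoose k"
  by (simp add: binomial_poly_def poly_prod gbinomial_prod_rev atLeast0LessThan)

lemma degree_binomial_poly: "degree (binomial_poly k) = k"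
  by (simp add: binomial_poly_def degree_prod_eq_sum_degree)

lemma lead_coeff_binomial_poly: "coeff (binomial_poly k) k = 1 / fact k"
proof -
  have "lead_coeff (\<Prod>i<k. [:- of_nat i, 1 :: rat:]) = 1"
    by (simp add: lead_coeff_prod)
  moreover have "degree (\<Prod>i<k. [:- of_nat i, 1 :: rat:]) = k"
    by (simp add: degree_prod_eq_sum_degree)
  ultimately show ?thesis by (simp add: binomial_poly_def)
qed

lemma poly_eqI_of_nat:
  fixes p q :: "rat poly"
  assumes "\<And>n::nat. poly p (of_nat n) = poly q (of_nat n)"
  shows "p = q"
proof (rule ccontr)
  assume "p \<noteq> q"
  then have "finite {x. poly (p - q) x = 0}"
    by (intro poly_roots_finite) simp
  moreover have "range (of_nat :: nat \<Rightarrow> rat) \<subseteq> {x. poly (p - q) x = 0}"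
    using assms by auto
  ultimately have "finite (range (of_nat :: nat \<Rightarrow> rat))"
    by (rule finite_subset[rotated])
  then show False
    using finite_imageD[of "of_nat :: nat \<Rightarrow> rat" UNIV] by (simp add: inj_of_nat)
qed

lemma binomial_expansion_iff:
  "binomial_expansion p c \<longleftrightarrow>
     (\<exists>N. (\<forall>k\<ge>N. c k = 0) \<and> p = (\<Sum>k<N. smult (c k) (binomial_poly k)))"
proof
  assume *: "binomial_expansion p c"
  then obtain N where N: "{k. c k \<noteq> 0} \<subseteq> {..<N}"
    unfolding binomial_expansion_def using finite_nat_iff_bounded by blast
  have "(\<Sum>k | c k \<noteq> 0. smult (c k) (binomial_poly k)) = (\<Sum>k<N. smult (c k) (binomial_poly k))"
    using N by (intro sum.mono_neutral_left) auto
  with * N show "\<exists>N. (\<forall>k\<ge>N. c k = 0) \<and> p = (\<Sum>k<N. smult (c k) (binomial_poly k))"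
    by (intro exI[of _ N]) (auto simp: binomial_expansion_def subset_iff not_less)
next
  assume "\<exists>N. (\<forall>k\<ge>N. c k = 0) \<and> p = (\<Sum>k<N. smult (c k) (binomial_poly k))"
  then obtain N where c: "\<forall>k\<ge>N. c k = 0" and p: "p = (\<Sum>k<N. smult (c k) (binomial_poly k))"
    by blast
  from c have N: "{k. c k \<noteq> 0} \<subseteq> {..<N}" by (auto simp: not_le[symmetric])
  have "(\<Sum>k | c k \<noteq> 0. smult (c k) (binomial_poly k)) = (\<Sum>k<N. smult (c k) (binomial_poly k))"
    using N by (intro sum.mono_neutral_left) auto
  with p N show "binomial_expansion p c"
    by (auto simp: binomial_expansion_def intro: finite_subset)
qed

lemma ex_binomial_expansion_degree:
  "degree p < N \<or> p = 0 \<Longrightarrow>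
     \<exists>c. (\<forall>k\<ge>N. c k = 0) \<and> p = (\<Sum>k<N. smult (c k) (binomial_poly k))"
proof (induction N arbitrary: p)
  case 0
  then show ?case by (intro exI[of _ "\<lambda>_. 0"]) auto
next
  case (Suc N)
  define a where "a = coeff p N * fact N"
  define q where "q = p - smult a (binomial_poly N)"
  have "degree q \<le> N"
    unfolding q_def using Suc.prems
    by (intro degree_diff_le) (auto simp: degree_binomial_poly intro: order.trans[OF degree_smult_le])
  moreover have "coeff q N = 0"
    by (simp add: q_def a_def lead_coeff_binomial_poly)
  ultimately have "degree q < N \<or> q = 0"
    by (metis leading_coeff_0_iff nat_less_le)
  from Suc.IH[OF this] obtain c where
    c: "\<forall>k\<ge>N. c k = 0" "q = (\<Sum>k<N. smult (c k) (binomial_poly k))" by blast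
  have "p = q + smult a (binomial_poly N)" by (simp add: q_def)
  also have "\<dots> = (\<Sum>k<Suc N. smult ((c(N := a)) k) (binomial_poly k))"
    by (simp add: c(2))
  finally show ?case
    using c(1) by (intro exI[of _ "c(N := a)"]) auto
qed

lemma sum_binomial_poly_eq_0:
  "(\<Sum>k<N. smult (c k) (binomial_poly k)) = 0 \<Longrightarrow> k < N \<Longrightarrow> c k = 0"
proof (induction N)
  case (Suc N)
  have "coeff (\<Sum>k<Suc N. smult (c k) (binomial_poly k)) N = c N / fact N"
    by (simp add: coeff_sum lead_coeff_binomial_poly coeff_eq_0 degree_binomial_poly)
  with Suc.prems(1) have "c N = 0" by simp
  with Suc show ?case by (auto simp: less_Suc_eq)
qed simp

lemma ex1_binomial_expansion: "\<exists>!c. binomial_expansion p c"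
proof (rule ex_ex1I)
  show "\<exists>c. binomial_expansion p c"
    using ex_binomial_expansion_degree[of p "Suc (degree p)"]
    unfolding binomial_expansion_iff by blast
next
  fix c d
  assume "binomial_expansion p c" "binomial_expansion p d"
  then have fin: "finite {k. c k \<noteq> 0}" "finite {k. d k \<noteq> 0}"
    and p: "p = (\<Sum>k | c k \<noteq> 0. smult (c k) (binomial_poly k))"
           "p = (\<Sum>k | d k \<noteq> 0. smult (d k) (binomial_poly k))"
    by (auto simp: binomial_expansion_def)
  from fin have "finite ({k. c k \<noteq> 0} \<union> {k. d k \<noteq> 0})" by simp
  then obtain N where N: "{k. c k \<noteq> 0} \<union> {k. d k \<noteq> 0} \<subseteq> {..<N}"
    using finite_nat_iff_bounded by blast
  have "p = (\<Sum>k<N. smult (c k) (binomial_poly k))"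
    unfolding p(1) using N by (intro sum.mono_neutral_left) auto
  moreover have "p = (\<Sum>k<N. smult (d k) (binomial_poly k))"
    unfolding p(2) using N by (intro sum.mono_neutral_left) auto
  ultimately have "(\<Sum>k<N. smult (c k - d k) (binomial_poly k)) = 0"
    by (simp add: smult_diff_left sum_subtractf)
  then have "c k - d k = 0" if "k < N" for k
    using sum_binomial_poly_eq_0[of "\<lambda>k. c k - d k"] that by blast
  moreover have "c k = d k" if "k \<ge> N" for k
  proof -
    from that N have "k \<notin> {k. c k \<noteq> 0} \<union> {k. d k \<noteq> 0}" by fastforce
    then show ?thesis by simp
  qed
  ultimately show "c = d"
    by (metis eq_iff_diff_eq_0 ext not_less)
qed

lemma sum_gbinomial: "(\<Sum>i<n. (of_nat i :: rat) gchoose k) = of_nat n gchoose Suc k"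
proof (induction n)
  case (Suc n)
  then show ?case
    using gbinomial_Suc_Suc[of "of_nat n :: rat" k] by (simp add: add.commute)
qed simp

lemma ex1_delta_sum:
  "\<exists>!P :: rat poly. \<forall>n::nat. poly P (of_nat n) = (\<Sum>i<n. poly f (of_nat i))"
proof (rule ex_ex1I)
  obtain c where "binomial_expansion f c"
    using ex1_binomial_expansion by blast
  then have f: "f = (\<Sum>k | c k \<noteq> 0. smult (c k) (binomial_poly k))"
    by (simp add: binomial_expansion_def)
  define P where "P = (\<Sum>k | c k \<noteq> 0. smult (c k) (binomial_poly (Suc k)))"
  have "poly P (of_nat n) = (\<Sum>i<n. poly f (of_nat i))" for n
  proof -
    have "(\<Sum>i<n. poly f (of_nat i)) = (\<Sum>i<n. \<Sum>k | c k \<noteq> 0. c k * (of_nat i gchoose k))"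
      by (simp add: f poly_sum poly_binomial_poly)
    also have "\<dots> = (\<Sum>k | c k \<noteq> 0. c k * (\<Sum>i<n. of_nat i gchoose k))"
      by (subst sum.swap) (simp add: sum_distrib_left)
    also have "\<dots> = poly P (of_nat n)"
      by (simp add: P_def poly_sum poly_binomial_poly sum_gbinomial)
    finally show ?thesis by simp
  qed
  then show "\<exists>P :: rat poly. \<forall>n::nat. poly P (of_nat n) = (\<Sum>i<n. poly f (of_nat i))"
    by blast
qed (auto intro: poly_eqI_of_nat)

fun leaves :: "plane_tree \<Rightarrow> nat" where
  "leaves Leaf = 1"
| "leaves (Node ts) = (\<Sum>t\<leftarrow>ts. leaves t)"

lemma leaves_word_tree: "leaves (word_tree w) = Suc (length w)"
proof (induction w rule: word_tree.induct)
  case (2 w)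
  then have "map (\<lambda>v. leaves (word_tree v)) (split_at (max_letter w) w)
      = map (\<lambda>v. Suc (length v)) (split_at (max_letter w) w)"
    by (intro map_cong) auto
  then have "(\<Sum>v\<leftarrow>split_at (max_letter w) w. leaves (word_tree v)) = Suc (length w)"
    by (simp only: sum_list_length_split_at)
  with 2 show ?case by (simp add: comp_def)
qed simp

lemma finite_words: "finite {u. packed u \<and> max_letter u = k \<and> word_tree u = T}"
proof (rule finite_subset)
  show "{u. packed u \<and> max_letter u = k \<and> word_tree u = T}
      \<subseteq> {u. set u \<subseteq> {..k} \<and> length u = leaves T - 1}"
    by (auto simp: max_letter_def leaves_word_tree)
  show "finite {u. set u \<subseteq> {..k} \<and> length u = leaves T - 1}"
    by (intro finite_lists_length_eq) simp
qed

end

(* Both sides are governed by the number N_T(n) of words over {1..n} with tree T.  Cutting a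
   word at its maximal letter i + 1 leaves arbitrary words over {1..i}, so N_T satisfies the
   recursion defining the polynomial of T, and the polynomial evaluates to N_T(n) at n.  On the
   other hand, a word is determined by its set of letters and its standardisation, which is a
   packed word with the same tree; hence N_T(n) = (SUM k. c_k (n choose k)) with c_k the number
   of packed words with maximal letter k and tree T. *)

theory Submission
  imports Defs
begin

lemma max_letter_map:
  assumes "strict_mono_on (set w) f" "w \<noteq> []"
  shows "max_letter (map f w) = f (max_letter w)"
proof -
  have "mono_on (set w) f" using assms(1) by (rule strict_mono_on_imp_mono_on)
  then have "Max (f ` set w) = f (Max (set w))"
    using assms(2) by (intro Max_eqI) (auto intro: mono_onD)
  with assms(2) show ?thesis by (simp add: max_letter_def)
qed

lemma max_letter_in_set: "w \<noteq> [] \<Longrightarrow> max_letter w \<in> set w"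
  by (simp add: max_letter_def del: Max_insert) (simp add: max_letter_def)

text \<open>Injectivity on the letters together with \<open>m\<close> guarantees that only
  occurrences of \<open>m\<close> become \<open>f m\<close>, so the cuts fall at the same
  positions.\<close>

lemma split_at_map:
  "inj_on f (insert m (set w)) \<Longrightarrow> split_at (f m) (map f w) = map (map f) (split_at m w)"
proof (induction w)
  case (Cons x w)
  have "inj_on f (insert m (set w))"
    using Cons.prems by (rule inj_on_subset) auto
  with Cons show ?case
    by (cases "split_at m w") (auto simp: inj_on_def)
qed simp

lemma set_join_with:
  "set (join_with m vs) = \<Union> (set ` set vs) \<union> (if 2 \<le> length vs then {m} else {})"
  by (induction m vs rule: join_with.induct) auto

lemma set_split_at_subset: "v \<in> set (split_at m w) \<Longrightarrow> set v \<subseteq> set w"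
  using set_join_with[of m "split_at m w"] by (auto simp: join_with_split_at)

text \<open>Only the relative order of the letters enters the tree: an increasing relabelling sends
  the maximal letter to the maximal letter, hence commutes with every cut. This is what makes
  standardisation preserve the tree.\<close>

lemma word_tree_map: "strict_mono_on (set w) f \<Longrightarrow> word_tree (map f w) = word_tree w"
proof (induction w rule: word_tree.induct)
  case (2 w)
  let ?m = "max_letter w"
  have "inj_on f (insert ?m (set w))"
    using 2 strict_mono_on_imp_inj_on max_letter_in_set by (metis insert_absorb)
  then have "split_at (max_letter (map f w)) (map f w) = map (map f) (split_at ?m w)"
    by (simp add: max_letter_map split_at_map 2)
  moreover have "word_tree (map f v) = word_tree v" if "v \<in> set (split_at ?m w)" for v
    using "2.IH"[OF that] "2.prems" set_split_at_subset[OF that]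
    by (auto intro: monotone_on_subset)
  ultimately show ?case using "2.hyps" by simp
qed simp

lemma word_tree_eq_Leaf_iff: "word_tree w = Leaf \<longleftrightarrow> w = []"
  by (cases w) auto

text \<open>These are the words counted by N_T(n). Letters between \<open>1\<close> and
  \<open>n\<close> may be missing, in contrast to packed words.\<close>

definition tree_words :: "plane_tree \<Rightarrow> nat \<Rightarrow> nat list set" where
  "tree_words T n = {w. set w \<subseteq> {1..n} \<and> word_tree w = T}"

lemma finite_tree_words: "finite (tree_words T n)"
proof (rule finite_subset)
  show "tree_words T n \<subseteq> {w. set w \<subseteq> {1..n} \<and> length w = leaves T - 1}"
    by (auto simp: tree_words_def leaves_word_tree)
qed (intro finite_lists_length_eq, simp)

lemma card_listset:
  "(\<And>A. A \<in> set As \<Longrightarrow> finite A) \<Longrightarrow> finite (listset As) \<and> card (listset As) = prod_list (map card As)"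
proof (induction As)
  case (Cons A As)
  have "listset (A # As) = case_prod (#) ` (A \<times> listset As)"
    by (auto simp: set_Cons_def)
  moreover have "inj_on (case_prod (#)) (A \<times> listset As)"
    by (auto simp: inj_on_def)
  ultimately show ?case
    using Cons by (simp add: card_image card_cartesian_product)
qed simp

text \<open>Reads a choice of one word per child as a list of pieces; the bound \<open>i\<close> is
  common to all children, just as all factors in \<open>F_op\<close> are evaluated at the same
  point.\<close>

lemma in_listset_tree_words:
  "vs \<in> listset (map (\<lambda>t. tree_words t i) ts) \<longleftrightarrow>
     map word_tree vs = ts \<and> (\<forall>v\<in>set vs. set v \<subseteq> {1..i})"
proof (induction ts arbitrary: vs)
  case (Cons t ts)
  then show ?case
    by (cases vs) (auto simp: set_Cons_def tree_words_def)
qed auto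

lemma max_letter_join_with:
  assumes "2 \<le> length vs" "\<forall>v\<in>set vs. set v \<subseteq> {..<m}"
  shows "max_letter (join_with m vs) = m"
  unfolding max_letter_def set_join_with using assms
  by (intro Max_eqI) (auto dest: less_imp_le)

text \<open>Cutting at the maximal letter \<open>Suc i\<close> and joining with it are inverse to
  each other. The pieces avoid that letter, so their letters are at most \<open>i\<close>;
  conversely, two or more pieces force the separator to occur, which makes it the maximum.\<close>

lemma tree_words_Node:
  assumes "2 \<le> length ts"
  shows "tree_words (Node ts) n =
    (\<Union>i<n. join_with (Suc i) ` listset (map (\<lambda>t. tree_words t i) ts))"
proof (intro set_eqI iffI)
  fix w assume w: "w \<in> tree_words (Node ts) n"
  then have "w \<noteq> []" by (auto simp: tree_words_def)
  define m vs where "m = max_letter w" and "vs = split_at m w"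
  have m: "m \<in> set w" using \<open>w \<noteq> []\<close> by (simp add: m_def max_letter_in_set)
  \<comment> \<open>Letters are positive, so the maximal one is a successor.\<close>
  with w obtain i where i: "m = Suc i" "i < n"
    by (cases m) (auto simp: tree_words_def)
  have "map word_tree vs = ts"
    using w \<open>w \<noteq> []\<close> by (simp add: tree_words_def vs_def m_def)
  moreover have "set v \<subseteq> {1..i}" if "v \<in> set vs" for v
  proof
    fix x assume "x \<in> set v"
    then have "x \<in> set w" "x \<noteq> m"
      using that set_split_at_subset[of v m w] split_at_pieces[of v m w] by (auto simp: vs_def)
    moreover have "x \<le> m" using \<open>x \<in> set w\<close> by (simp add: m_def max_letter_def)
    ultimately show "x \<in> {1..i}" using w i by (auto simp: tree_words_def)
  qed
  ultimately have "vs \<in> listset (map (\<lambda>t. tree_words t i) ts)"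
    by (simp add: in_listset_tree_words)
  moreover have "w = join_with (Suc i) vs"
    by (simp add: vs_def join_with_split_at flip: i(1))
  ultimately show "w \<in> (\<Union>i<n. join_with (Suc i) ` listset (map (\<lambda>t. tree_words t i) ts))"
    using i by blast
next
  fix w assume "w \<in> (\<Union>i<n. join_with (Suc i) ` listset (map (\<lambda>t. tree_words t i) ts))"
  then obtain i vs where i: "i < n" and w: "w = join_with (Suc i) vs"
    and vs: "map word_tree vs = ts" "\<forall>v\<in>set vs. set v \<subseteq> {1..i}"
    by (auto simp: in_listset_tree_words)
  have len: "2 \<le> length vs" using assms vs(1) by auto
  have less: "\<forall>v\<in>set vs. set v \<subseteq> {..<Suc i}" using vs(2) by fastforce
  have "split_at (Suc i) w = vs"
    unfolding w using len less by (intro split_at_join_with) auto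
  moreover have "max_letter w = Suc i"
    unfolding w using len less by (rule max_letter_join_with)
  moreover have "set w \<subseteq> {1..n}" "w \<noteq> []"
    using set_join_with[of "Suc i" vs] len i vs(2) unfolding w by fastforce+
  ultimately show "w \<in> tree_words (Node ts) n"
    using vs(1) by (simp add: tree_words_def)
qed

text \<open>The union over \<open>i\<close> is disjoint because the maximal letter of a joined word
  recovers \<open>i\<close>, and each joining map is injective because \<open>split_at\<close>
  undoes it.\<close>

lemma card_tree_words_Node:
  assumes "2 \<le> length ts"
  shows "card (tree_words (Node ts) n) = (\<Sum>i<n. \<Prod>t\<leftarrow>ts. card (tree_words t i))"
proof -
  let ?L = "\<lambda>i. listset (map (\<lambda>t. tree_words t i) ts)"
  have L: "finite (?L i) \<and> card (?L i) = (\<Prod>t\<leftarrow>ts. card (tree_words t i))" for i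
    using card_listset[of "map (\<lambda>t. tree_words t i) ts"] finite_tree_words
    by (auto simp: comp_def)
  have props: "split_at (Suc i) (join_with (Suc i) vs) = vs \<and> max_letter (join_with (Suc i) vs) = Suc i"
    if "vs \<in> ?L i" for i vs
  proof -
    have "2 \<le> length vs" "\<forall>v\<in>set vs. set v \<subseteq> {..<Suc i}"
      using that assms unfolding in_listset_tree_words by fastforce+
    then show ?thesis
      by (auto intro!: split_at_join_with max_letter_join_with)
  qed
  have "inj_on (join_with (Suc i)) (?L i)" for i
    using props by (intro inj_on_inverseI[of _ "split_at (Suc i)"]) blast
  then have "card (join_with (Suc i) ` ?L i) = (\<Prod>t\<leftarrow>ts. card (tree_words t i))" for i
    using L by (simp add: card_image)
  moreover have "card (\<Union>i<n. join_with (Suc i) ` ?L i) = (\<Sum>i<n. card (join_with (Suc i) ` ?L i))"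
  proof (rule card_UN_disjoint)
    show "\<forall>i\<in>{..<n}. \<forall>j\<in>{..<n}. i \<noteq> j \<longrightarrow>
        join_with (Suc i) ` ?L i \<inter> join_with (Suc j) ` ?L j = {}"
      using props by (fastforce dest: arg_cong[of _ _ max_letter])
  qed (use L in auto)
  ultimately show ?thesis
    by (simp add: tree_words_Node[OF assms])
qed

lemma poly_delta_sum: "poly (delta_sum f) (of_nat n) = (\<Sum>i<n. poly f (of_nat i))"
  using theI'[OF ex1_delta_sum[of f]] by (simp add: delta_sum_def)

lemma poly_prod_list: "poly (prod_list ps) x = (\<Prod>p\<leftarrow>ps. poly p x)"
  by (induction ps) auto

lemma of_nat_prod_list: "of_nat (prod_list xs) = prod_list (map of_nat xs)"
  by (induction xs) auto

text \<open>The empty word is the only one with tree \<open>Leaf\<close>, and at a node both sides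
  satisfy the same summation recursion; \<open>reduced\<close> supplies the two children that the
  counting recursion asks for.\<close>

lemma poly_tree_poly:
  "reduced T \<Longrightarrow> poly (tree_poly T) (of_nat n) = of_nat (card (tree_words T n))"
proof (induction T arbitrary: n rule: reduced.induct)
  case 1
  have "tree_words Leaf n = {[]}" by (auto simp: tree_words_def word_tree_eq_Leaf_iff)
  then show ?case by simp
next
  case (2 ts)
  have "map (\<lambda>t. poly (tree_poly t) (of_nat i)) ts
      = map (\<lambda>t. of_nat (card (tree_words t i))) ts" for i
    using 2 by (intro map_cong) auto
  then have "(\<Prod>t\<leftarrow>ts. poly (tree_poly t) (of_nat i))
      = of_nat (\<Prod>t\<leftarrow>ts. card (tree_words t i))" for i
    by (simp only: of_nat_prod_list map_map comp_def)
  with 2(2) show ?case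
    by (simp add: F_op_def poly_delta_sum poly_prod_list card_tree_words_Node comp_def)
qed

text \<open>The increasing enumeration of \<open>S\<close>, applied letter by letter, is a
  tree-preserving bijection; its inverse is standardisation.\<close>

lemma card_words_with_letters:
  assumes "finite S"
  shows "card {w. set w = S \<and> word_tree w = T}
    = card {u. set u = {1..card S} \<and> word_tree u = T}"
proof -
  \<comment> \<open>The shift reconciles letters, which start at \<open>1\<close>, with list
    positions, which start at \<open>0\<close>.\<close>
  let ?f = "\<lambda>i. sorted_list_of_set S ! (i - 1)"
  have mono: "strict_mono_on {1..card S} ?f"
    using strict_sorted_list_of_set[of S]
    by (intro strict_mono_onI sorted_wrt_nth_less[of "(<)"]) auto
  then have inj: "inj_on ?f {1..card S}" by (rule strict_mono_on_imp_inj_on)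
  have img: "?f ` {1..card S} = S"
  proof -
    have "?f ` {1..card S} \<subseteq> S"
      using nth_mem[of _ "sorted_list_of_set S"] assms by auto
    moreover have "card (?f ` {1..card S}) = card S" using inj by (simp add: card_image)
    ultimately show ?thesis using assms by (intro card_subset_eq)
  qed
  have "{w. set w = S \<and> word_tree w = T} = map ?f ` {u. set u = {1..card S} \<and> word_tree u = T}"
  proof (intro set_eqI iffI)
    fix w assume w: "w \<in> {w. set w = S \<and> word_tree w = T}"
    then have "w \<in> lists (?f ` {1..card S})" using img by auto
    then obtain u where u: "w = map ?f u" "set u \<subseteq> {1..card S}"
      by (auto simp: lists_image)
    have "?f ` set u = ?f ` {1..card S}" using w u img by auto
    then have "set u = {1..card S}" using inj u(2) by (simp add: inj_on_image_eq_iff)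
    moreover from this have "word_tree u = T" using w u word_tree_map mono by auto
    ultimately show "w \<in> map ?f ` {u. set u = {1..card S} \<and> word_tree u = T}" using u by blast
  next
    fix w assume "w \<in> map ?f ` {u. set u = {1..card S} \<and> word_tree u = T}"
    then show "w \<in> {w. set w = S \<and> word_tree w = T}"
      using img mono by (auto simp: word_tree_map)
  qed
  moreover have "inj_on (map ?f) {u. set u = {1..card S} \<and> word_tree u = T}"
    using inj by (intro inj_on_mapI) (auto intro: inj_on_subset)
  ultimately show ?thesis by (simp only: card_image)
qed

text \<open>The interval \<open>{1..j}\<close> with \<open>0\<close> inserted has maximum
  \<open>j\<close> even for \<open>j = 0\<close>, so the witness in \<open>packed\<close> is the
  maximal letter.\<close>

lemma packed_max_letter_iff: "packed u \<and> max_letter u = k \<longleftrightarrow> set u = {1..k}"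
proof -
  have "Max (insert 0 {1..j}) = j" for j :: nat by (intro Max_eqI) auto
  then show ?thesis unfolding packed_def max_letter_def by metis
qed

lemma card_tree_words:
  "card (tree_words T n)
    = (\<Sum>k\<le>n. card {u. packed u \<and> max_letter u = k \<and> word_tree u = T} * (n choose k))"
proof -
  define c where "c k = card {u. set u = {1..k} \<and> word_tree u = T}" for k
  have "tree_words T n = (\<Union>S\<in>Pow {1..n}. {w. set w = S \<and> word_tree w = T})"
    by (auto simp: tree_words_def)
  also have "card \<dots> = (\<Sum>S\<in>Pow {1..n}. card {w. set w = S \<and> word_tree w = T})"
    by (intro card_UN_disjoint)
       (auto intro!: finite_subset[OF _ finite_tree_words[of T n]] simp: tree_words_def)
  also have "\<dots> = (\<Sum>S\<in>Pow {1..n}. c (card S))"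
    unfolding c_def by (intro sum.cong refl card_words_with_letters) (auto intro: finite_subset)
  \<comment> \<open>The summand depends only on the size of the letter set, and
    \<open>n choose k\<close> letter sets have size \<open>k\<close>.\<close>
  also have "\<dots> = (\<Sum>k\<le>n. \<Sum>S | S \<in> Pow {1..n} \<and> card S = k. c (card S))"
  proof (rule sum.group[symmetric])
    show "card ` Pow {1..n} \<subseteq> {..n}" using card_mono[of "{1..n}"] by auto
  qed auto
  also have "\<dots> = (\<Sum>k\<le>n. c k * (n choose k))"
    by (intro sum.cong refl) (simp add: n_subsets mult.commute)
  finally show ?thesis
    by (simp only: c_def packed_max_letter_iff conj_assoc[symmetric])
qed

theorem theorem3p1:
  fixes T :: plane_tree and k :: nat
  assumes "reduced T"
  shows "binomial_coeff (tree_poly T) k =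
    of_nat (card {u :: nat list. packed u \<and> max_letter u = k \<and> word_tree u = T})"
proof -
  define a where "a k = card {u. packed u \<and> max_letter u = k \<and> word_tree u = T}" for k
  \<comment> \<open>A word with tree \<open>T\<close> has length \<open>leaves T - 1\<close>, while
    a packed word with maximal letter \<open>k\<close> has length at least \<open>k\<close>; so
    \<open>a\<close> vanishes from \<open>N\<close> on.\<close>
  define N where "N = leaves T"
  have a0: "a k = 0" if "N \<le> k" for k
  proof -
    have "k \<le> length u" if "packed u" "max_letter u = k" for u
      using that packed_max_letter_iff[of u k] card_length[of u] by simp
    then have "{u. packed u \<and> max_letter u = k \<and> word_tree u = T} = {}"
      using that leaves_word_tree by (fastforce simp: N_def)
    then show ?thesis by (simp only: a_def card.empty)
  qed
  have "tree_poly T = (\<Sum>k<N. smult (of_nat (a k)) (binomial_poly k))"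
  proof (rule poly_eqI_of_nat)
    fix n :: nat
    \<comment> \<open>The ranges differ only in zero terms: \<open>n choose k\<close> vanishes for
      \<open>k > n\<close>, and \<open>a k\<close> for \<open>k \<ge> N\<close>. The bound thus
      becomes independent of \<open>n\<close>, as a polynomial identity requires.\<close>
    have "(\<Sum>k\<le>n. a k * (n choose k)) = (\<Sum>k<N. a k * (n choose k))"
      by (rule sum.mono_neutral_cong) (auto simp: a0 not_le not_less)
    then have "card (tree_words T n) = (\<Sum>k<N. a k * (n choose k))"
      by (simp add: card_tree_words a_def)
    then show "poly (tree_poly T) (of_nat n) =
        poly (\<Sum>k<N. smult (of_nat (a k)) (binomial_poly k)) (of_nat n)"
      by (simp add: poly_tree_poly[OF assms] poly_sum poly_binomial_poly binomial_gbinomial)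
  qed
  then have "binomial_expansion (tree_poly T) (\<lambda>k. of_nat (a k))"
    unfolding binomial_expansion_iff using a0 by (metis of_nat_0)
  then have "binomial_coeff (tree_poly T) = (\<lambda>k. of_nat (a k))"
    unfolding binomial_coeff_def by (intro the1_equality ex1_binomial_expansion)
  then show ?thesis by (simp add: a_def)
qed

end
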